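(* Let $\mathbb{K}$ be a field of characteristic $0$, let $L=\sum_{i=0}^{J}a_i(k)\sigma^i\in \mathbb{K}[k][\sigma]$ with $a_J(k)\ne0$ be power-partible with respect to $\gamma\in\mathbb{K}$, and let $d=\deg(L)$. For each $s\in\mathbb{N}$ let $\alpha_s\in\mathbb{K}\setminus\{0\}$ and $x_{s}(k)=\alpha_s\,(k-\gamma+\tfrac{J}{2})^s$. Then for every positive integer $m$ there exist $u_i,v_j\in\mathbb{K}$ such that $$(k-\gamma)^m=\sum_{\substack{0\le i<d\\ i\equiv m \pmod 2}}u_i(k-\gamma)^i+\sum_{\substack{0\le j\le m-d\\ d+j\equiv m \pmod 2}}v_j\,L^\ast(x_j(k)).$$
   Context: $\sigma$ is the shift operator, $\sigma F(k)=F(k+1)$. The adjoint of $L$ acts on polynomials by $L^{\ast}(x(k))=\sum_{i=0}^{J}a_i(k-i)x(k-i)$. Set $b_{\ell}(k)=\sum_{j=\ell}^{J}\binom{j}{\ell}a_{J-j}(k+j-J)$ for $0\le\ell\le J$ and $d=\deg(L)=\max_{0\le\ell\le J}\{\deg b_\ell(k)-\ell\}$. Let $f(s)=\sum_{\ell=0}^{J}[k^{d+\ell}](b_\ell(k))\,s^{\underline{\ell}}$ ($[k^m](b)$ the coefficient of $k^m$ in $b$, $s^{\underline{\ell}}=s(s-1)\cdots(s-\ell+1)$); $L$ is nondegenerated if $f$ has no root in $\mathbb{N}=\{0,1,2,\dots\}$. $L$ is called power-partible with respect to $\gamma$ if $L$ is nondegenerated and $a_i(\gamma+k)=(-1)^d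 a_{J-i}(\gamma-k-J)$ for $i=0,1,\ldots,\lfloor J/2\rfloor$. *)

theory Defs
  imports "HOL-Computational_Algebra.Polynomial" "HOL-Number_Theory.Cong"
begin

text \<open>
  An operator \<open>L = (\<Sum>i\<le>J. a\<^sub>i(k) \<sigma>^i)\<close> in \<open>K[k][\<sigma>]\<close> is given by its order \<open>J\<close> and its coefficient
  sequence \<open>a\<close>; only the values \<open>a 0, \<dots>, a J\<close> matter.
\<close>

definition translate :: "'a::comm_ring_1 \<Rightarrow> 'a poly \<Rightarrow> 'a poly" where
  "translate c p = pcompose p [:c, 1:]"

definition adjoint_op :: "nat \<Rightarrow> (nat \<Rightarrow> 'a::field_char_0 poly) \<Rightarrow> 'a poly \<Rightarrow> 'a poly" where
  "adjoint_op J a x = (\<Sum>i\<le>J. translate (- of_nat i) (a i) * translate (- of_nat i) x)"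

definition b_coeff :: "nat \<Rightarrow> (nat \<Rightarrow> 'a::field_char_0 poly) \<Rightarrow> nat \<Rightarrow> 'a poly" where
  "b_coeff J a l = (\<Sum>j=l..J. of_nat (j choose l) * translate (of_nat j - of_nat J) (a (J - j)))"

text \<open>
  The degree of the zero polynomial is \<open>-\<infinity>\<close> here (in the library it is \<open>0\<close>), so vanishing \<open>b\<^sub>l\<close> do not
  contribute to the maximum.  If \<open>L\<close> is nonzero, some \<open>b\<^sub>l\<close> is nonzero and the maximum is over a
  nonempty set.  The degree of an operator may be negative.
\<close>

definition op_degree :: "nat \<Rightarrow> (nat \<Rightarrow> 'a::field_char_0 poly) \<Rightarrow> int" where
  "op_degree J a = Max {int (degree (b_coeff J a l)) - int l | l. l \<le> J \<and> b_coeff J a l \<noteq> 0}"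

definition int_coeff :: "'a::zero poly \<Rightarrow> int \<Rightarrow> 'a" where
  "int_coeff p n = (if n < 0 then 0 else coeff p (nat n))"

definition falling_fact :: "'a::comm_ring_1 \<Rightarrow> nat \<Rightarrow> 'a" where
  "falling_fact s l = (\<Prod>i<l. s - of_nat i)"

definition indicial :: "nat \<Rightarrow> (nat \<Rightarrow> 'a::field_char_0 poly) \<Rightarrow> 'a \<Rightarrow> 'a" where
  "indicial J a s =
     (\<Sum>l\<le>J. int_coeff (b_coeff J a l) (op_degree J a + int l) * falling_fact s l)"

definition nondegenerated :: "nat \<Rightarrow> (nat \<Rightarrow> 'a::field_char_0 poly) \<Rightarrow> bool" where
  "nondegenerated J a \<longleftrightarrow> (\<forall>n::nat. indicial J a (of_nat n) \<noteq> 0)"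

text \<open>
  The symmetry condition is the polynomial identity
  \<open>a\<^sub>i(\<gamma> + k) = (-1)^d a\<^bsub>J-i\<^esub>(\<gamma> - k - J)\<close> in \<open>k\<close>.
\<close>

definition power_partible :: "nat \<Rightarrow> (nat \<Rightarrow> 'a::field_char_0 poly) \<Rightarrow> 'a \<Rightarrow> bool" where
  "power_partible J a \<gamma> \<longleftrightarrow>
     nondegenerated J a \<and>
     (\<forall>i \<le> J div 2. pcompose (a i) [:\<gamma>, 1:] =
        smult ((-1) powi op_degree J a) (pcompose (a (J - i)) [:\<gamma> - of_nat J, -1:]))"

end

theory Submission
  imports Defs
begin

text \<open>
  Let \<open>y = k - \<gamma>\<close>. Writing \<open>L\<^sup>*\<close> in terms of the forward difference shows that \<open>L\<^sup>*(x\<^sub>s)\<close> has degree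
  exactly \<open>d + s\<close>, with leading coefficient \<open>\<alpha>\<^sub>s\<close> times the value at \<open>s\<close> of the indicial polynomial.
  The symmetry of the coefficients makes \<open>L\<^sup>*(x\<^sub>s)\<close> even or odd in \<open>y\<close>, according to the
  parity of \<open>d + s\<close>. So a polynomial of definite parity in \<open>y\<close> can be reduced
  degree by degree, using \<open>L\<^sup>*(x\<^sub>s)\<close> in degrees \<open>d + s\<close> and powers of \<open>y\<close> in degrees below \<open>d\<close>.
\<close>

section \<open>Translations and forward differences\<close>

lemma poly_translate [simp]: "poly (translate c p) y = poly p (c + y)"
  by (simp add: translate_def poly_pcompose)

lemma translate_add: "translate c (p + q) = translate c p + translate c q"
  by (simp add: translate_def pcompose_add)

lemma translate_smult: "translate c (smult r p) = smult r (translate c p)"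
  by (simp add: translate_def pcompose_smult)

lemma translate_translate: "translate c (translate e p) = translate (c + e) p"
  by (simp add: translate_def flip: pcompose_assoc) (simp add: pcompose_pCons add.commute)

lemma degree_translate [simp]: "degree (translate c p) = degree (p :: 'a::idom poly)"
  by (simp add: translate_def degree_pcompose)

lemma translate_linear_power:
  "translate c ([:e, 1:] ^ s) = ([:c + e, 1:] :: 'a::comm_ring_1 poly) ^ s"
  by (induction s)
    (simp_all add: translate_def pcompose_mult pcompose_pCons pcompose_1 add.commute del: mult_pCons_left)

definition forward_difference :: "'a::comm_ring_1 poly \<Rightarrow> 'a poly" where
  "forward_difference p = translate 1 p - p"

lemma translate_1_eq: "translate 1 p = forward_difference p + p"
  by (simp add: forward_difference_def)

text \<open>Induction on \<open>p\<close>: for the forward difference \<open>\<Delta>\<close>,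
  \<open>\<Delta>(c + k p) = k \<Delta>p + \<Delta>p + p\<close>. The hypothesis only bounds the
  degree, and \<open>coeff p (Suc n)\<close> may be zero, so that the lemma can be iterated.\<close>

lemma coeff_forward_difference:
  assumes "\<And>i. i > Suc n \<Longrightarrow> coeff p i = 0"
  shows "coeff (forward_difference p) n = of_nat (Suc n) * coeff p (Suc n)"
  using assms
proof (induction p arbitrary: n)
  case 0
  then show ?case by (simp add: forward_difference_def translate_def)
next
  case (pCons c p)
  have eq: "forward_difference (pCons c p) = pCons 0 (forward_difference p) + forward_difference p + p"
    by (simp add: forward_difference_def translate_def pcompose_pCons)
  have van: "coeff p i = 0" if "i > n" for i
    using pCons.prems[of "Suc i"] that by simp
  \<comment> \<open>Here \<open>coeff p (Suc n)\<close> is already zero, so only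
    \<open>k \<Delta>p\<close> and \<open>p\<close> contribute to the coefficient at
    \<open>n\<close>.\<close>
  have *: "coeff (forward_difference p) n = 0"
    using pCons.IH[of n] van by simp
  show ?case
  proof (cases n)
    case 0
    then show ?thesis using * by (simp add: eq)
  next
    case (Suc r)
    have "coeff (forward_difference p) r = of_nat (Suc r) * coeff p (Suc r)"
      using pCons.IH[of r] van Suc by simp
    then show ?thesis using * Suc by (simp add: eq algebra_simps)
  qed
qed

text \<open>Each difference lowers the degree by at least one. In terms of coefficients this
  includes the vanishing of all differences with \<open>l > s\<close>, which a bound on
  \<open>degree\<close> would hide because the zero polynomial has \<open>degree\<close> 0.\<close>

lemma coeff_forward_difference_power_eq_0:
  assumes "\<And>i. i > s \<Longrightarrow> coeff p i = 0" "n + l > s"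
  shows "coeff ((forward_difference ^^ l) p) n = 0"
  using assms(2)
proof (induction l arbitrary: n)
  case 0
  then show ?case using assms(1) by simp
next
  case (Suc l)
  then show ?case by (simp add: coeff_forward_difference)
qed

text \<open>Successive differences multiply the top coefficient by \<open>s\<close>,
  \<open>s - 1\<close>, ..., \<open>s - l + 1\<close>. This is the source of the falling factorials
  in \<open>indicial\<close>.\<close>

lemma coeff_forward_difference_power:
  assumes "\<And>i. i > s \<Longrightarrow> coeff p i = 0" "l \<le> s"
  shows "coeff ((forward_difference ^^ l) p) (s - l) = falling_fact (of_nat s) l * coeff p s"
  using assms(2)
proof (induction l)
  case 0
  then show ?case by (simp add: falling_fact_def)
next
  case (Suc l)
  have s: "Suc (s - Suc l) = s - l" using Suc.prems by simp
  have "coeff ((forward_difference ^^ Suc l) p) (s - Suc l)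
      = of_nat (s - l) * coeff ((forward_difference ^^ l) p) (s - l)"
    using coeff_forward_difference[of "s - Suc l" "(forward_difference ^^ l) p"]
      coeff_forward_difference_power_eq_0[of s p _ l] assms(1) by (simp add: s)
  also have "\<dots> = of_nat (s - l) * (falling_fact (of_nat s) l * coeff p s)"
    using Suc by simp
  finally show ?case
    using Suc.prems by (simp add: falling_fact_def of_nat_diff mult.commute mult.left_commute)
qed

lemma falling_fact_of_nat_eq_0: "l > s \<Longrightarrow> falling_fact (of_nat s :: 'a::comm_ring_1) l = 0"
  unfolding falling_fact_def by (rule prod_zero) auto

lemma translate_1_sum:
  "translate 1 (\<Sum>i\<in>A. f i) = (\<Sum>i\<in>A. translate 1 (f i))"
  by (simp add: translate_def pcompose_sum)

text \<open>The binomial expansion of \<open>(1 + \<Delta>)^j\<close>, where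
  \<open>1 + \<Delta>\<close> is the shift by 1; the induction uses Pascal's rule.\<close>

lemma translate_of_nat:
  fixes p :: "'a::comm_ring_1 poly"
  shows "translate (of_nat j) p = (\<Sum>l\<le>j. of_nat (j choose l) * (forward_difference ^^ l) p)"
proof (induction j)
  case 0
  then show ?case by (simp add: translate_def)
next
  case (Suc j)
  let ?D = "\<lambda>l. (forward_difference ^^ l) p"
  have shift: "translate 1 (of_nat c * q) = of_nat c * (forward_difference q + q)"
    for c and q :: "'a poly"
    by (simp add: of_nat_poly translate_smult translate_1_eq)
  have "translate (of_nat (Suc j)) p = translate 1 (translate (of_nat j) p)"
    by (simp add: translate_translate)
  also have "\<dots> = (\<Sum>l\<le>j. of_nat (j choose l) * ?D (Suc l)) + (\<Sum>l\<le>j. of_nat (j choose l) * ?D l)"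
    by (simp add: Suc translate_1_sum shift distrib_left sum.distrib)
  \<comment> \<open>The added term has binomial coefficient 0. Splitting off \<open>l = 0\<close>
    afterwards aligns the two sums for Pascal's rule.\<close>
  also have "(\<Sum>l\<le>j. of_nat (j choose l) * ?D l)
      = (\<Sum>l\<le>Suc j. of_nat (j choose l) * ?D l)"
    by (simp add: binomial_eq_0)
  also have "\<dots> = ?D 0 + (\<Sum>l\<le>j. of_nat (j choose Suc l) * ?D (Suc l))"
    by (subst sum.atMost_Suc_shift) simp
  also have "(\<Sum>l\<le>j. of_nat (j choose l) * ?D (Suc l)) + \<dots>
      = (\<Sum>l\<le>Suc j. of_nat (Suc j choose l) * ?D l)"
    by (subst sum.atMost_Suc_shift) (simp add: sum.distrib distrib_right)
  finally show ?case .
qed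

section \<open>Degree and leading coefficient of the adjoint\<close>

text \<open>With \<open>j = J - i\<close>, the shift by \<open>-i\<close> is the shift by
  \<open>-J\<close> followed by the shift by \<open>j \<ge> 0\<close>, which expands into
  differences. Collecting the factors of the \<open>l\<close>-th difference yields exactly
  \<open>b_coeff J a l\<close>.\<close>

lemma adjoint_op_eq:
  fixes a :: "nat \<Rightarrow> 'a::field_char_0 poly"
  shows "adjoint_op J a p =
    (\<Sum>l\<le>J. b_coeff J a l * (forward_difference ^^ l) (translate (- of_nat J) p))"
proof -
  define X where "X = translate (- of_nat J) p"
  define A where "A = (\<lambda>j. translate (of_nat j - of_nat J) (a (J - j)))"
  have "adjoint_op J a p = (\<Sum>j\<le>J. translate (- of_nat (J - j)) (a (J - j)) * translate (- of_nat (J - j)) p)"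
    unfolding adjoint_op_def
    by (rule sum.reindex_bij_witness[of _ "\<lambda>j. J - j" "\<lambda>j. J - j"]) auto
  also have "\<dots> = (\<Sum>j\<le>J. A j * translate (of_nat j) X)"
    by (intro sum.cong refl) (simp add: A_def X_def translate_translate of_nat_diff)
  also have "\<dots> = (\<Sum>j\<le>J. \<Sum>l\<le>J. of_nat (j choose l) * A j * (forward_difference ^^ l) X)"
  proof (intro sum.cong refl)
    fix j assume "j \<in> {..J}"
    \<comment> \<open>Extending the range from \<open>l \<le> j\<close> to \<open>l \<le> J\<close>
      adds only zero terms and makes the double sum rectangular, ready for the exchange of
      sums.\<close>
    then have "translate (of_nat j) X = (\<Sum>l\<le>J. of_nat (j choose l) * (forward_difference ^^ l) X)"
      unfolding translate_of_nat by (intro sum.mono_neutral_left) auto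
    then show "A j * translate (of_nat j) X
        = (\<Sum>l\<le>J. of_nat (j choose l) * A j * (forward_difference ^^ l) X)"
      by (simp add: sum_distrib_left mult_ac)
  qed
  also have "\<dots> = (\<Sum>l\<le>J. (\<Sum>j\<le>J. of_nat (j choose l) * A j) * (forward_difference ^^ l) X)"
    by (subst sum.swap) (simp add: sum_distrib_right)
  also have "\<dots> = (\<Sum>l\<le>J. b_coeff J a l * (forward_difference ^^ l) X)"
  proof (intro sum.cong refl arg_cong2[where f = "(*)"])
    fix l
    show "(\<Sum>j\<le>J. of_nat (j choose l) * A j) = b_coeff J a l"
      unfolding b_coeff_def A_def by (intro sum.mono_neutral_right) (auto simp: not_le)
  qed
  finally show ?thesis by (simp add: X_def)
qed

text \<open>Only the index pair \<open>(r, s)\<close> survives in the convolution at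
  \<open>r + s\<close>. The bounds need not be attained: \<open>b_coeff J a l\<close> may have
  degree below \<open>d + l\<close>.\<close>

lemma coeff_mult_bounded:
  fixes p q :: "'a::comm_semiring_0 poly"
  assumes "\<And>i. i > r \<Longrightarrow> coeff p i = 0" "\<And>i. i > s \<Longrightarrow> coeff q i = 0"
  shows "coeff (p * q) (r + s) = coeff p r * coeff q s"
    and "n > r + s \<Longrightarrow> coeff (p * q) n = 0"
proof -
  have "coeff p i * coeff q (r + s - i) = 0" if "i \<noteq> r" for i
    using that assms by (cases "i < r") auto
  then have "(\<Sum>i\<le>r + s. coeff p i * coeff q (r + s - i))
      = (\<Sum>i\<in>{r}. coeff p i * coeff q (r + s - i))"
    by (intro sum.mono_neutral_right) auto
  then show "coeff (p * q) (r + s) = coeff p r * coeff q s"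
    by (simp add: coeff_mult)
next
  assume "n > r + s"
  then have "coeff p i * coeff q (n - i) = 0" for i
    using assms by (cases "i > r") auto
  then show "coeff (p * q) n = 0" by (simp add: coeff_mult)
qed

lemma coeff_b_coeff_eq_0:
  assumes "l \<le> J" "int n > op_degree J a + int l"
  shows "coeff (b_coeff J a l) n = 0"
proof (cases "b_coeff J a l = 0")
  case False
  then have "int (degree (b_coeff J a l)) - int l \<le> op_degree J a"
    unfolding op_degree_def using assms(1) by (intro Max_ge) auto
  then show ?thesis using assms(2) by (intro coeff_eq_0) simp
qed simp

text \<open>At \<open>s = 0\<close> only the term \<open>l = 0\<close> of \<open>indicial\<close>
  can survive, and it is the coefficient at \<open>d\<close>. If \<open>d < 0\<close>, this is 0 by
  \<open>int_coeff\<close>, so 0 would be a root.\<close>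

lemma nondegenerated_op_degree_nonneg:
  assumes "nondegenerated J a"
  shows "op_degree J a \<ge> 0"
proof (rule ccontr)
  assume neg: "\<not> op_degree J a \<ge> 0"
  have "int_coeff (b_coeff J a l) (op_degree J a + int l) * falling_fact 0 l = 0" for l
    using neg falling_fact_of_nat_eq_0[of 0 l] by (cases "l = 0") (auto simp: int_coeff_def)
  then have "indicial J a (of_nat 0) = 0" unfolding indicial_def by (intro sum.neutral) simp
  then show False using assms unfolding nondegenerated_def by blast
qed

text \<open>In the difference form, the \<open>l\<close>-th summand has degree at most
  \<open>(D + l) + (s - l) = D + s\<close>, and its coefficient there is \<open>coeff p s\<close>
  times the \<open>l\<close>-th term of \<open>indicial\<close> at \<open>s\<close>.\<close>

lemma coeff_adjoint_op:
  fixes a :: "nat \<Rightarrow> 'a::field_char_0 poly"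
  assumes "op_degree J a = int D" "degree p \<le> s"
  shows "coeff (adjoint_op J a p) (D + s) = indicial J a (of_nat s) * coeff p s"
    and "n > D + s \<Longrightarrow> coeff (adjoint_op J a p) n = 0"
proof -
  define X where "X = translate (- of_nat J) p"
  have X0: "coeff X i = 0" if "i > s" for i
    using that assms(2) by (intro coeff_eq_0) (simp add: X_def)
  have Xs: "coeff X s = coeff p s"
  proof (cases "degree p = s")
    case True
    have "lead_coeff X = lead_coeff p"
      unfolding X_def translate_def by (subst lead_coeff_comp) auto
    then show ?thesis using True by (simp add: X_def)
  next
    case False
    then show ?thesis using assms(2) by (simp add: X_def coeff_eq_0)
  qed
  have b0: "coeff (b_coeff J a l) i = 0" if "l \<le> J" "i > D + l" for l i
    using coeff_b_coeff_eq_0[of l J a i] that assms(1) by simp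
  have D0: "coeff ((forward_difference ^^ l) X) i = 0" if "i + l > s" for i l
    using coeff_forward_difference_power_eq_0[of s X i l] X0 that by simp
  have vanish: "(forward_difference ^^ l) X = 0" if "l > s" for l
    using D0[of _ l] that by (intro poly_eqI) simp
  have term0: "coeff (b_coeff J a l * (forward_difference ^^ l) X) n = 0"
    if "l \<le> J" "n > D + s" for l n
  proof (cases "l \<le> s")
    case True
    then show ?thesis
      using that b0 D0 by (intro coeff_mult_bounded(2)[of "D + l" _ "s - l"]) auto
  qed (use vanish in simp)
  have "coeff (b_coeff J a l * (forward_difference ^^ l) X) (D + s)
      = int_coeff (b_coeff J a l) (op_degree J a + int l) * falling_fact (of_nat s) l * coeff p s"
    if "l \<le> J" for l
  \<comment> \<open>For \<open>l > s\<close> the subtraction \<open>s - l\<close> would be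
    truncated, but then both the difference and the falling factorial are zero.\<close>
  proof (cases "l \<le> s")
    case True
    have "coeff (b_coeff J a l * (forward_difference ^^ l) X) (D + l + (s - l))
        = coeff (b_coeff J a l) (D + l) * coeff ((forward_difference ^^ l) X) (s - l)"
      using that b0 D0 True by (intro coeff_mult_bounded(1)) auto
    moreover have "nat (int D + int l) = D + l" by simp
    ultimately show ?thesis
      using True coeff_forward_difference_power[of s X l] X0
      by (simp add: int_coeff_def assms(1) Xs mult.assoc)
  qed (simp add: vanish falling_fact_of_nat_eq_0)
  then show "coeff (adjoint_op J a p) (D + s) = indicial J a (of_nat s) * coeff p s"
    by (simp add: adjoint_op_eq coeff_sum indicial_def sum_distrib_right flip: X_def)
  show "coeff (adjoint_op J a p) n = 0" if "n > D + s"
    using term0 that by (simp add: adjoint_op_eq coeff_sum flip: X_def)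
qed

section \<open>Reflection about \<gamma> and parity\<close>

text \<open>The condition for \<open>i \<le> J div 2\<close> gives all \<open>i \<le> J\<close>, because it is an involution under
  \<open>i \<mapsto> J - i\<close>, \<open>k \<mapsto> - k - J\<close>.\<close>

lemma power_partible_symmetry:
  fixes a :: "nat \<Rightarrow> 'a::field_char_0 poly"
  assumes "power_partible J a \<gamma>" "op_degree J a = int D" "i \<le> J"
  shows "poly (a i) (\<gamma> + k) = (-1) ^ D * poly (a (J - i)) (\<gamma> - of_nat J - k)"
proof -
  have low: "poly (a i) (\<gamma> + k) = (-1) ^ D * poly (a (J - i)) (\<gamma> - of_nat J - k)"
    if "i \<le> J div 2" for i k
  proof -
    have "pcompose (a i) [:\<gamma>, 1:] =
        smult ((-1) ^ D) (pcompose (a (J - i)) [:\<gamma> - of_nat J, -1:])"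
      using assms(1,2) that by (simp add: power_partible_def)
    then have "poly (pcompose (a i) [:\<gamma>, 1:]) k =
        poly (smult ((-1) ^ D) (pcompose (a (J - i)) [:\<gamma> - of_nat J, -1:])) k"
      by simp
    then show ?thesis by (simp add: poly_pcompose)
  qed
  show ?thesis
  proof (cases "i \<le> J div 2")
    case False
    then have "J - i \<le> J div 2" by simp
    from low[OF this, of "- of_nat J - k"] show ?thesis
      using assms(3) by (simp add: algebra_simps flip: power_add mult_2)
  qed (rule low)
qed

text \<open>The reflection \<open>y \<mapsto> -y\<close> exchanges the summands \<open>i\<close> and
  \<open>J - i\<close>: the coefficient contributes the sign \<open>(-1)^D\<close>, the power
  \<open>p\<close> the sign \<open>(-1)^s\<close>.\<close>

lemma poly_adjoint_op_reflect:
  fixes a :: "nat \<Rightarrow> 'a::field_char_0 poly"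
  assumes "power_partible J a \<gamma>" "op_degree J a = int D"
    and p: "p = smult c ([: - \<gamma> + of_nat J / 2, 1:] ^ s)"
  shows "poly (adjoint_op J a p) (\<gamma> - y) = (-1) ^ (D + s) * poly (adjoint_op J a p) (\<gamma> + y)"
proof -
  have refla: "poly (a i) (\<gamma> - y - of_nat i) = (-1) ^ D * poly (a (J - i)) (\<gamma> + y - of_nat (J - i))"
    if "i \<le> J" for i
    using power_partible_symmetry[OF assms(1,2) that, of "- y - of_nat i"] that
    by (simp add: of_nat_diff algebra_simps)
  have reflp: "poly p (\<gamma> - y - of_nat i) = (-1) ^ s * poly p (\<gamma> + y - of_nat (J - i))"
    if "i \<le> J" for i
  proof -
    \<comment> \<open>The offset \<open>J / 2\<close> in \<open>p\<close> is chosen for this: it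
      makes the base of the power change sign when \<open>i\<close> and \<open>J - i\<close> are
      exchanged.\<close>
    have "of_nat J / 2 - y - of_nat i = - (of_nat J / 2 + y - of_nat (J - i))"
      using that by (simp add: of_nat_diff field_simps)
    then have "(of_nat J / 2 - y - of_nat i) ^ s = (-1) ^ s * (of_nat J / 2 + y - of_nat (J - i)) ^ s"
      by (metis power_minus)
    then show ?thesis by (simp add: p poly_power algebra_simps)
  qed
  have "poly (adjoint_op J a p) (\<gamma> - y)
      = (\<Sum>i\<le>J. poly (a i) (\<gamma> - y - of_nat i) * poly p (\<gamma> - y - of_nat i))"
    by (simp add: adjoint_op_def poly_sum)
  also have "\<dots> = (\<Sum>i\<le>J. (-1) ^ (D + s) *
      (poly (a (J - i)) (\<gamma> + y - of_nat (J - i)) * poly p (\<gamma> + y - of_nat (J - i))))"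
    by (intro sum.cong refl) (simp add: refla reflp power_add)
  also have "\<dots> = (\<Sum>i\<le>J. (-1) ^ (D + s) *
      (poly (a i) (\<gamma> + y - of_nat i) * poly p (\<gamma> + y - of_nat i)))"
    by (rule sum.reindex_bij_witness[of _ "\<lambda>i. J - i" "\<lambda>i. J - i"]) auto
  finally show ?thesis
    by (simp add: adjoint_op_def poly_sum sum_distrib_left)
qed

text \<open>Comparing coefficients of \<open>p(-k)\<close> and \<open>(-1)^n p(k)\<close> at an
  index of the wrong parity gives \<open>c = -c\<close>, hence \<open>c = 0\<close> in
  characteristic 0.\<close>

lemma coeff_eq_0_if_parity:
  fixes p :: "'a::field_char_0 poly"
  assumes "\<And>y. poly p (- y) = (-1) ^ n * poly p y" "\<not> [i = n] (mod 2)"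
  shows "coeff p i = 0"
proof -
  have "pcompose p [:0, -1:] = smult ((-1) ^ n) p"
    by (intro poly_eq_poly_eq_iff[THEN iffD1] ext) (simp add: poly_pcompose assms(1))
  then have "(-1) ^ i * coeff p i = (-1) ^ n * coeff p i"
    by (metis coeff_pcompose_linear coeff_smult)
  moreover have "even i \<longleftrightarrow> odd n"
    using assms(2) unfolding cong_def by presburger
  ultimately have "2 * coeff p i = 0"
    by (cases "even n") (auto simp: eq_neg_iff_add_eq_0 neg_eq_iff_add_eq_0 simp flip: mult_2)
  then show ?thesis by simp
qed

section \<open>Reduction of polynomials of fixed parity\<close>

theorem theorem2p6:
  fixes J :: nat and a :: "nat \<Rightarrow> 'a::field_char_0 poly" and \<gamma> :: 'a
    and d :: int and \<alpha> :: "nat \<Rightarrow> 'a" and x :: "nat \<Rightarrow> 'a poly" and m :: nat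
  assumes "a J \<noteq> 0"
    and "power_partible J a \<gamma>"
    and "d = op_degree J a"
    and "\<And>s. \<alpha> s \<noteq> 0"
    and "\<And>s. x s = smult (\<alpha> s) ([: - \<gamma> + of_nat J / 2, 1:] ^ s)"
    and "m > 0"
  shows "\<exists>u v :: nat \<Rightarrow> 'a.
    [: - \<gamma>, 1:] ^ m =
      (\<Sum>i | int i < d \<and> [i = m] (mod 2). smult (u i) ([: - \<gamma>, 1:] ^ i)) +
      (\<Sum>j | int j \<le> int m - d \<and> [d + int j = int m] (mod 2). smult (v j) (adjoint_op J a (x j)))"
proof -
  have nd: "nondegenerated J a" using assms(2) by (simp add: power_partible_def)
  then obtain D where D: "op_degree J a = int D"
    using nondegenerated_op_degree_nonneg nonneg_int_cases by blast
  define I where "I = {i. int i < d \<and> [i = m] (mod 2)}"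
  define K where "K = {j. int j \<le> int m - d \<and> [d + int j = int m] (mod 2)}"
  have "I \<subseteq> {..<D}" "K \<subseteq> {..m}"
    by (auto simp: I_def K_def D assms(3))
  then have fin: "finite I" "finite K"
    by (auto intro: finite_subset)
  have K_iff: "j \<in> K \<longleftrightarrow> D + j \<le> m \<and> [D + j = m] (mod 2)" for j
    by (auto simp: K_def D assms(3) simp flip: cong_int_iff)
  \<comment> \<open>All possible right-hand sides. This set contains 0 and is closed under adding
    multiples of its generators, which is all that the reduction uses.\<close>
  define S where "S = {(\<Sum>i\<in>I. smult (u i) ([: - \<gamma>, 1:] ^ i)) +
      (\<Sum>j\<in>K. smult (v j) (adjoint_op J a (x j))) | u v. True}"
  have S0: "0 \<in> S"
    unfolding S_def by (rule CollectI, rule exI[of _ "\<lambda>_. 0"], rule exI[of _ "\<lambda>_. 0"]) simp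
  have S_add_pow: "p + smult c ([: - \<gamma>, 1:] ^ i) \<in> S" if p: "p \<in> S" and i: "i \<in> I" for p c i
  proof -
    obtain u v where uv: "p = (\<Sum>i\<in>I. smult (u i) ([: - \<gamma>, 1:] ^ i)) +
        (\<Sum>j\<in>K. smult (v j) (adjoint_op J a (x j)))"
      using p unfolding S_def by blast
    have "(\<Sum>k\<in>I. smult ((u(i := u i + c)) k) ([: - \<gamma>, 1:] ^ k))
        = (\<Sum>k\<in>I. smult (u k) ([: - \<gamma>, 1:] ^ k)) + smult c ([: - \<gamma>, 1:] ^ i)"
      using fin(1) i by (simp add: sum.remove[of I i] smult_add_left)
    then have "p + smult c ([: - \<gamma>, 1:] ^ i) = (\<Sum>k\<in>I. smult ((u(i := u i + c)) k) ([: - \<gamma>, 1:] ^ k)) +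
        (\<Sum>j\<in>K. smult (v j) (adjoint_op J a (x j)))"
      by (simp only: uv) (simp only: add_ac)
    then show ?thesis unfolding S_def by blast
  qed
  have S_add_adj: "p + smult c (adjoint_op J a (x j)) \<in> S" if p: "p \<in> S" and j: "j \<in> K" for p c j
  proof -
    obtain u v where uv: "p = (\<Sum>i\<in>I. smult (u i) ([: - \<gamma>, 1:] ^ i)) +
        (\<Sum>j\<in>K. smult (v j) (adjoint_op J a (x j)))"
      using p unfolding S_def by blast
    have "(\<Sum>k\<in>K. smult ((v(j := v j + c)) k) (adjoint_op J a (x k)))
        = (\<Sum>k\<in>K. smult (v k) (adjoint_op J a (x k))) + smult c (adjoint_op J a (x j))"
      using fin(2) j by (simp add: sum.remove[of K j] smult_add_left)
    then have "p + smult c (adjoint_op J a (x j)) = (\<Sum>i\<in>I. smult (u i) ([: - \<gamma>, 1:] ^ i)) +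
        (\<Sum>k\<in>K. smult ((v(j := v j + c)) k) (adjoint_op J a (x k)))"
      by (simp only: uv) (simp only: add_ac)
    then show ?thesis unfolding S_def by blast
  qed
  \<comment> \<open>\<open>Q j\<close> is the adjoint image of \<open>x j\<close> written in the
    variable \<open>y = k - \<gamma>\<close>, where parity becomes the vanishing of every other
    coefficient.\<close>
  define Q where "Q = (\<lambda>j. translate \<gamma> (adjoint_op J a (x j)))"
  have trQ: "translate (- \<gamma>) (Q j) = adjoint_op J a (x j)" for j
    by (simp add: Q_def translate_translate) (simp add: translate_def)
  have degx: "degree (x s) = s" and coeffx: "coeff (x s) s = \<alpha> s" for s
    using assms(4)[of s] by (simp_all add: assms(5) degree_linear_power coeff_linear_power)
  have degL: "degree (adjoint_op J a (x s)) = D + s"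
    and Lnz: "coeff (adjoint_op J a (x s)) (D + s) \<noteq> 0" for s
  proof -
    \<comment> \<open>The factor \<open>indicial J a (of_nat s)\<close> is nonzero by nondegeneracy,
      the factor \<open>\<alpha> s\<close> by assumption.\<close>
    show *: "coeff (adjoint_op J a (x s)) (D + s) \<noteq> 0"
      using coeff_adjoint_op(1)[OF D, of "x s" s] nd assms(4)[of s]
      by (simp add: degx coeffx nondegenerated_def)
    show "degree (adjoint_op J a (x s)) = D + s"
      using coeff_adjoint_op(2)[OF D, of "x s" s] degx *
      by (intro antisym degree_le le_degree) auto
  qed
  have degQ: "degree (Q s) = D + s" for s by (simp add: Q_def degL)
  have Qnz: "coeff (Q s) (D + s) \<noteq> 0" for s
    using degQ[of s] Lnz[of s] trQ[of s]
    by (metis coeff_0 leading_coeff_0_iff pcompose_0 translate_def)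
  have Qpar: "coeff (Q s) i = 0" if "\<not> [i = D + s] (mod 2)" for s i
  proof (rule coeff_eq_0_if_parity[OF _ that])
    show "poly (Q s) (- y) = (-1) ^ (D + s) * poly (Q s) y" for y
      using poly_adjoint_op_reflect[OF assms(2) D assms(5), of s y] by (simp add: Q_def)
  qed
  \<comment> \<open>Here \<open>p\<close> is a polynomial in \<open>y\<close> and \<open>N\<close> a
    strict bound on the exponents that occur in it. The bound \<open>N \<le> Suc m\<close> ensures
    that every generator used in the reduction has degree at most \<open>m\<close>.\<close>
  have main: "translate (- \<gamma>) p \<in> S"
    if "N \<le> Suc m" "\<And>i. coeff p i \<noteq> 0 \<Longrightarrow> i < N \<and> [i = m] (mod 2)" for N p
    using that
  proof (induction N arbitrary: p)
    case 0
    then have "p = 0" by (intro poly_eqI) auto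
    then show ?case using S0 by (simp add: translate_def)
  next
    case (Suc N)
    have IH: "translate (- \<gamma>) q \<in> S" if "\<And>i. i \<ge> N \<Longrightarrow> coeff q i = 0"
      and "\<And>i. \<not> [i = m] (mod 2) \<Longrightarrow> coeff q i = 0" for q
      using that Suc.prems(1) by (intro Suc.IH) (auto simp: not_le[symmetric])
    have p_high: "coeff p i = 0" if "i > N" for i using Suc.prems(2)[of i] that by auto
    have p_par: "coeff p i = 0" if "\<not> [i = m] (mod 2)" for i using Suc.prems(2)[of i] that by auto
    consider "\<not> [N = m] (mod 2)" | "[N = m] (mod 2)" "N < D" | "[N = m] (mod 2)" "N \<ge> D"
      by linarith
    then show ?case
    proof cases
      case 1
      then show ?thesis using p_high p_par by (intro IH) (auto simp: le_less)
    next
      case 2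
      define c where "c = coeff p N"
      \<comment> \<open>Removing the top term keeps the parity and lowers the bound to
        \<open>N\<close>.\<close>
      have "translate (- \<gamma>) (p - monom c N) \<in> S"
        using 2 p_high p_par by (intro IH) (auto simp: c_def le_less)
      moreover have "N \<in> I" using 2 by (simp add: I_def D assms(3))
      ultimately have "translate (- \<gamma>) (p - monom c N) + smult c ([: - \<gamma>, 1:] ^ N) \<in> S"
        by (rule S_add_pow)
      moreover have "smult c ([: - \<gamma>, 1:] ^ N) = translate (- \<gamma>) (monom c N)"
        using translate_linear_power[of "- \<gamma>" 0 N]
        by (simp add: monom_altdef translate_smult)
      ultimately show ?thesis by (simp flip: translate_add)
    next
      case 3
      define j where "j = N - D"
      have N: "N = D + j" using 3 by (simp add: j_def)
      \<comment> \<open>Chosen to cancel the coefficient at \<open>N\<close>. As \<open>Q j\<close>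
        has degree \<open>N = D + j\<close> and the parity of \<open>N\<close>, hence of
        \<open>m\<close>, the difference stays within the induction hypothesis.\<close>
      define c where "c = coeff p N / coeff (Q j) N"
      have top: "coeff p N = c * coeff (Q j) N" using Qnz[of j] by (simp add: c_def N)
      have "coeff (Q j) i = 0" if "i > N" for i using that degQ[of j] N by (simp add: coeff_eq_0)
      moreover have "coeff (Q j) i = 0" if "\<not> [i = m] (mod 2)" for i
        using that 3(1) Qpar[of i j] unfolding N by (metis cong_trans)
      ultimately have "translate (- \<gamma>) (p - smult c (Q j)) \<in> S"
        using p_high p_par top by (intro IH) (auto simp: le_less)
      moreover have "j \<in> K" using 3(1) Suc.prems(1) by (simp add: K_iff N)
      ultimately have "translate (- \<gamma>) (p - smult c (Q j)) + smult c (adjoint_op J a (x j)) \<in> S"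
        by (rule S_add_adj)
      then show ?thesis by (simp flip: translate_add translate_smult trQ)
    qed
  qed
  \<comment> \<open>The power \<open>(k - \<gamma>)^m\<close> is \<open>y^m\<close>, whose only
    exponent \<open>m\<close> lies below the strict bound \<open>Suc m\<close>.\<close>
  have "translate (- \<gamma>) (monom 1 m) \<in> S"
    by (rule main[of "Suc m"]) (auto split: if_splits)
  moreover have "translate (- \<gamma>) (monom 1 m) = [: - \<gamma>, 1:] ^ m"
    using translate_linear_power[of "- \<gamma>" 0 m] by (simp add: monom_altdef)
  ultimately show ?thesis unfolding S_def I_def K_def by auto
qed

end
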